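(* Let $x_0 \in (0,\infty)$, $\alpha \in (0,1)$, $\beta \in (0,1)$, $c \in (0,\frac12]$ and $\Delta \in (0,\infty)$, and let $f : \mathbb{R}^{2\times 2} \to \mathbb{R}$ be defined by $$f(X) := \frac{X_{1,1}^2 + (X_{2,2}-1)^2 + (X_{1,2}-X_{2,1})^2}{2}.$$ Consider the minimization of $f$ on $\mathbb{R}^{2\times 2}_{\le 1}$. Starting from $X_0 := \operatorname{diag}(x_0,0)$ and using $\bar\alpha := \underline{\alpha} := \alpha$, $\beta$, $c$ and $\Delta$, the algorithm $\mathrm{P}^2\mathrm{GDR}$ produces the sequence $(X_i)_{i\in\mathbb{N}}$ defined by $$X_i := \begin{cases} \operatorname{diag}((1-\alpha)^i x_0, 0) & \text{if } i \le i_\Delta,\\ \operatorname{diag}(0, 1-(1-\alpha)^{i-i_\Delta}) & \text{if } i > i_\Delta,\end{cases} \qquad\text{where } i_\Delta := \max\left\{\left\lceil \frac{\ln(\Delta/x_0)}{\ln(1-\alpha)} \right\rceil, 0\right\}.$$ In particular, $(X_i)_{i\in\mathbb{N}}$ converges to $\operatorname{diag}(0,1)$ and $\lim_{i\to\infty} \mathrm{s}_f(X_i) = 0$.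
   Context: $\mathbb{N}$ includes $0$. $\mathbb{R}^{2\times 2}$ carries the Frobenius inner product and $\|\cdot\|$ is the Frobenius norm; gradients are taken with respect to this inner product. $\mathbb{R}^{2\times 2}_{\le 1} := \{X \in \mathbb{R}^{2\times 2} \mid \operatorname{rank} X \le 1\}$ and, for an integer $s \ge 0$, $\mathbb{R}^{2\times 2}_{s} := \{X \in \mathbb{R}^{2\times 2} \mid \operatorname{rank} X = s\}$. For a nonempty set $\mathcal{S} \subseteq \mathbb{R}^{2\times 2}$ and $X \in \mathbb{R}^{2\times 2}$, $P_{\mathcal{S}}(X) := \operatorname{argmin}_{Y\in\mathcal{S}} \|X-Y\|$ (a set, identified with its element when it is a singleton). For $X \in \mathcal{S}$, the tangent cone $T_{\mathcal{S}}(X)$ is the set of all $V \in \mathbb{R}^{2\times 2}$ for which there exist $(t_i)_{i\in\mathbb{N}}$ in $(0,\infty)$ converging to $0$ and $(V_i)_{i\in\mathbb{N}}$ in $\mathbb{R}^{2\times 2}$ converging to $V$ such that $X+t_iV_i \in \mathcal{S}$ for every $i$; it is a closed cone, and for a closed cone $\mathcal{C}$ all elements of $P_{\mathcal{C}}(X)$ have the same norm. Stationarity measure: for $X \in \mathbb{R}^{2\times 2}_{\le 1}$, $\mathrm{s}_f(X) := \|P_{T_{\mathbb{R}^{2\times 2}_{\le 1}}(X)}(-\nabla f(X))\|$ (norm of any element of this projection). $\Delta$-rank: for $X \ne 0$ with singular values $\sigma_1(X) \ge \sigma_2(X)$, $\operatorname{rank}_\Delta X := \max\{j \in \{1,\dots,\operatorname{rank}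 X\} \mid \sigma_j(X) > \Delta\}$, with the convention that the maximum of the empty set is $0$; $\operatorname{rank}_\Delta 0_{2\times 2} := 0$. $\mathrm{P}^2\mathrm{GD}$ map with parameters $0 < \underline{\alpha} \le \bar\alpha < \infty$, $\beta, c \in (0,1)$: given $X \in \mathbb{R}^{2\times 2}_{\le 1}$ with $\mathrm{s}_f(X) > 0$, choose $G \in P_{T_{\mathbb{R}^{2\times 2}_{\le 1}}(X)}(-\nabla f(X))$, a step size $\alpha \in [\underline{\alpha},\bar\alpha]$, and $Y \in P_{\mathbb{R}^{2\times 2}_{\le 1}}(X+\alpha G)$; while $f(Y) > f(X) - c\,\alpha\,\mathrm{s}_f(X)^2$, replace $\alpha$ by $\alpha\beta$ and choose a new $Y \in P_{\mathbb{R}^{2\times 2}_{\le 1}}(X+\alpha G)$; then return $Y$. The set of all possible outputs is $\mathrm{P}^2\mathrm{GD}(X; f,\underline{\alpha},\bar\alpha,\beta,c)$. $\mathrm{P}^2\mathrm{GDR}$ map with the same parameters and $\Delta \in (0,\infty)$: given $X \in \mathbb{R}^{2\times 2}_{\le 1}$ with $\mathrm{s}_f(X) > 0$, for each $j \in \{0,\dots,\operatorname{rank} X - \operatorname{rank}_\Delta X\}$ choose $\hat X^j \in P_{\mathbb{R}^{2\times 2}_{\operatorname{rank} X - j}}(X)$ and $\tilde X^j \in \mathrm{P}^2\mathrm{GD}(\hat X^j; f,\underline{\alpha},\bar\alpha,\beta,c)$; then return some $Y$ minimizing $f$ over the finite set of all the $\tilde X^j$. The set of all possible outputs is $\mathrm{P}^2\mathrm{GDR}(X;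 f,\underline{\alpha},\bar\alpha,\beta,c,\Delta)$. The algorithm $\mathrm{P}^2\mathrm{GDR}$ (with stopping tolerance $0$): starting from $X_0 \in \mathbb{R}^{2\times 2}_{\le 1}$, as long as $\mathrm{s}_f(X_i) > 0$, choose $X_{i+1} \in \mathrm{P}^2\mathrm{GDR}(X_i; f,\underline{\alpha},\bar\alpha,\beta,c,\Delta)$. "Produces the sequence $(X_i)$" means that the algorithm never stops and that its iterates are the $X_i$. *)

theory Defs
  imports "HOL-Analysis.Analysis"
begin

(* On real^2^2 the library's inner product and norm are the Frobenius ones. *)
type_synonym mat2 = "real^2^2"

definition diag2 :: "real \<Rightarrow> real \<Rightarrow> mat2" where
  "diag2 a b = vector [vector [a, 0], vector [0, b]]"

definition rank_le1 :: "mat2 set" where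
  "rank_le1 = {X. rank X \<le> 1}"

definition rank_eq :: "nat \<Rightarrow> mat2 set" where
  "rank_eq s = {X. rank X = s}"

definition proj :: "'a::real_normed_vector set \<Rightarrow> 'a \<Rightarrow> 'a set" where
  "proj S X = {Y. is_arg_min (\<lambda>Y. norm (X - Y)) (\<lambda>Y. Y \<in> S) Y}"

definition tangent_cone :: "'a::real_normed_vector set \<Rightarrow> 'a \<Rightarrow> 'a set" where
  "tangent_cone S X =
     {V. \<exists>(t :: nat \<Rightarrow> real) W. (\<forall>i. t i > 0) \<and> t \<longlonglongrightarrow> 0 \<and> W \<longlonglongrightarrow> V \<and>
           (\<forall>i. X + t i *\<^sub>R W i \<in> S)}"

definition grad :: "('a::real_inner \<Rightarrow> real) \<Rightarrow> 'a \<Rightarrow> 'a" where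
  "grad f X = (THE D. GDERIV f X :> D)"

definition proj_neg_grad :: "(mat2 \<Rightarrow> real) \<Rightarrow> mat2 \<Rightarrow> mat2 set" where
  "proj_neg_grad f X = proj (tangent_cone rank_le1 X) (- grad f X)"

(* The choice is immaterial: all projections onto a closed cone have the same norm. *)
definition stat_measure :: "(mat2 \<Rightarrow> real) \<Rightarrow> mat2 \<Rightarrow> real" where
  "stat_measure f X = norm (SOME G. G \<in> proj_neg_grad f X)"

definition is_svd :: "mat2 \<Rightarrow> mat2 \<Rightarrow> real \<Rightarrow> real \<Rightarrow> mat2 \<Rightarrow> bool" where
  "is_svd X U s1 s2 V \<longleftrightarrow>
     orthogonal_matrix U \<and> orthogonal_matrix V \<and> s1 \<ge> s2 \<and> s2 \<ge> 0 \<and>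
     X = U ** diag2 s1 s2 ** transpose V"

definition singular_values :: "mat2 \<Rightarrow> real \<times> real" where
  "singular_values X = (THE s. \<exists>U V. is_svd X U (fst s) (snd s) V)"

(* Only the indices j = 1 and j = 2 are meaningful. *)
definition sing_val :: "mat2 \<Rightarrow> nat \<Rightarrow> real" where
  "sing_val X j = (if j = 1 then fst (singular_values X) else snd (singular_values X))"

definition delta_rank :: "real \<Rightarrow> mat2 \<Rightarrow> nat" where
  "delta_rank \<Delta> X =
     (let J = {j \<in> {1..rank X}. sing_val X j > \<Delta>}
      in if X = 0 \<or> J = {} then 0 else Max J)"

(* The pairs (a, Y) of trial step size and trial point that the backtracking loop
   can visit, for a fixed choice of the projected negative gradient G. *)
inductive backtracking ::
    "(mat2 \<Rightarrow> real) \<Rightarrow> real \<Rightarrow> real \<Rightarrow> real \<Rightarrow> real \<Rightarrow> mat2 \<Rightarrow> mat2 \<Rightarrow> real \<Rightarrow> mat2 \<Rightarrow> bool"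
  for f :: "mat2 \<Rightarrow> real" and al au \<beta> c :: real and X G :: mat2
where
  start: "\<lbrakk>al \<le> a; a \<le> au; Y \<in> proj rank_le1 (X + a *\<^sub>R G)\<rbrakk>
          \<Longrightarrow> backtracking f al au \<beta> c X G a Y"
| shrink: "\<lbrakk>backtracking f al au \<beta> c X G a Y; f Y > f X - c * a * (stat_measure f X)\<^sup>2;
            Y' \<in> proj rank_le1 (X + (a * \<beta>) *\<^sub>R G)\<rbrakk>
          \<Longrightarrow> backtracking f al au \<beta> c X G (a * \<beta>) Y'"

definition p2gd ::
    "(mat2 \<Rightarrow> real) \<Rightarrow> real \<Rightarrow> real \<Rightarrow> real \<Rightarrow> real \<Rightarrow> mat2 \<Rightarrow> mat2 set" where
  "p2gd f al au \<beta> c X =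
     {Y. X \<in> rank_le1 \<and> stat_measure f X > 0 \<and>
         (\<exists>G \<in> proj_neg_grad f X. \<exists>a. backtracking f al au \<beta> c X G a Y \<and>
            \<not> f Y > f X - c * a * (stat_measure f X)\<^sup>2)}"

definition p2gdr ::
    "(mat2 \<Rightarrow> real) \<Rightarrow> real \<Rightarrow> real \<Rightarrow> real \<Rightarrow> real \<Rightarrow> real \<Rightarrow> mat2 \<Rightarrow> mat2 set" where
  "p2gdr f al au \<beta> c \<Delta> X =
     {Y. X \<in> rank_le1 \<and> stat_measure f X > 0 \<and>
         (\<exists>Xhat Xtilde :: nat \<Rightarrow> mat2.
            (\<forall>j \<in> {0..rank X - delta_rank \<Delta> X}.
               Xhat j \<in> proj (rank_eq (rank X - j)) X \<and>
               Xtilde j \<in> p2gd f al au \<beta> c (Xhat j)) \<and>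
            is_arg_min f (\<lambda>Z. Z \<in> Xtilde ` {0..rank X - delta_rank \<Delta> X}) Y)}"

(* Z 0, ..., Z n are possible first iterates from X0, the algorithm having
   performed n iterations without meeting its stopping criterion. *)
definition p2gdr_iterates ::
    "(mat2 \<Rightarrow> real) \<Rightarrow> real \<Rightarrow> real \<Rightarrow> real \<Rightarrow> real \<Rightarrow> real \<Rightarrow> mat2 \<Rightarrow> nat \<Rightarrow> (nat \<Rightarrow> mat2) \<Rightarrow> bool"
  where
  "p2gdr_iterates f al au \<beta> c \<Delta> X0 n Z \<longleftrightarrow>
     Z 0 = X0 \<and>
     (\<forall>i<n. stat_measure f (Z i) > 0 \<and> Z (Suc i) \<in> p2gdr f al au \<beta> c \<Delta> (Z i))"

(* X is a possible infinite run, and every run, whatever choices are made, follows X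
   as far as it goes; in particular no run meets the stopping criterion. *)
definition p2gdr_produces ::
    "(mat2 \<Rightarrow> real) \<Rightarrow> real \<Rightarrow> real \<Rightarrow> real \<Rightarrow> real \<Rightarrow> real \<Rightarrow> mat2 \<Rightarrow> (nat \<Rightarrow> mat2) \<Rightarrow> bool"
  where
  "p2gdr_produces f al au \<beta> c \<Delta> X0 X \<longleftrightarrow>
     (\<forall>n. p2gdr_iterates f al au \<beta> c \<Delta> X0 n X) \<and>
     (\<forall>n Z. p2gdr_iterates f al au \<beta> c \<Delta> X0 n Z \<longrightarrow> (\<forall>i\<le>n. Z i = X i))"

end

theory Submission
  imports Defs
begin

text \<open>On the two half-lines of diagonal matrices carrying the iterates, every choice in the
  algorithm is forced. At \<open>diag(a, 0)\<close> with \<open>a > 0\<close> the tangent cone hides the entry 1 of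
  \<open>-\<nabla>f\<close> in position (2,2), so the step only shrinks \<open>a\<close> by the factor \<open>1 - \<alpha>\<close>; at \<open>diag(0, b)\<close>
  the whole of \<open>-\<nabla>f\<close> is tangent and the step shrinks \<open>1 - b\<close> by that factor. Both steps stay in
  the set of matrices of rank at most 1 and satisfy the Armijo condition at once because
  \<open>c \<le> 1/2 < 1 - \<alpha>/2\<close>. The reduced candidate \<open>diag(0, \<alpha>)\<close>, obtained from 0, enters the
  competition when the nonzero singular value is at most \<open>\<Delta>\<close>; it beats every \<open>diag(a, 0)\<close> but
  loses against the step from \<open>diag(0, b)\<close> with \<open>b > 0\<close>.\<close>

section \<open>Coordinates, norm and rank of 2 by 2 matrices\<close>

lemma diag2_nth [simp]:
  "diag2 a b $ 1 $ 1 = a" "diag2 a b $ 1 $ 2 = 0"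
  "diag2 a b $ 2 $ 1 = 0" "diag2 a b $ 2 $ 2 = b"
  by (simp_all add: diag2_def)

lemma mat2_eq_iff:
  "(A::mat2) = B \<longleftrightarrow> A$1$1 = B$1$1 \<and> A$1$2 = B$1$2 \<and> A$2$1 = B$2$1 \<and> A$2$2 = B$2$2"
  by (auto simp: vec_eq_iff forall_2)

lemma inner_mat2:
  "(A::mat2) \<bullet> B = A$1$1 * B$1$1 + A$1$2 * B$1$2 + A$2$1 * B$2$1 + A$2$2 * B$2$2"
  by (simp add: inner_vec_def sum_2)

lemma diag2_add_scaleR: "diag2 a b + t *\<^sub>R diag2 a' b' = diag2 (a + t * a') (b + t * b')"
  by (simp add: mat2_eq_iff)

lemma diag2_eq_0_iff: "diag2 a b = 0 \<longleftrightarrow> a = 0 \<and> b = 0"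
  by (auto simp: mat2_eq_iff)

lemma det_diag2: "det (diag2 a b) = a * b"
  by (simp add: det_2)

lemma norm_mat2_eq: "norm (A::mat2) = sqrt ((A$1$1)\<^sup>2 + (A$1$2)\<^sup>2 + (A$2$1)\<^sup>2 + (A$2$2)\<^sup>2)"
  by (simp add: norm_eq_sqrt_inner inner_mat2 power2_eq_square)

lemma norm_diag2_zero [simp]: "norm (diag2 a 0) = \<bar>a\<bar>" "norm (diag2 0 b) = \<bar>b\<bar>"
  by (simp_all add: norm_mat2_eq)

lemma rank_le1_iff_det: "(A::mat2) \<in> rank_le1 \<longleftrightarrow> det A = 0"
  by (auto simp: rank_le1_def det_eq_0_rank)

lemma rank_diag2_zero:
  "a \<noteq> 0 \<Longrightarrow> rank (diag2 a 0) = 1" "b \<noteq> 0 \<Longrightarrow> rank (diag2 0 b) = 1"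
  using rank_le1_iff_det[of "diag2 a 0"] rank_le1_iff_det[of "diag2 0 b"]
    rank_eq_0[of "diag2 a 0"] rank_eq_0[of "diag2 0 b"]
  by (auto simp: rank_le1_def det_diag2 diag2_eq_0_iff)

section \<open>Metric projections, tangent cones and gradients\<close>

lemma proj_eq_singleton:
  fixes Z :: "'a::real_inner"
  assumes "G \<in> S" and orth: "\<And>V. V \<in> S \<Longrightarrow> (Z - G) \<bullet> (V - G) = 0"
  shows "proj S Z = {G}"
proof -
  have "norm (Z - G) < norm (Z - V)" if "V \<in> S" "V \<noteq> G" for V
  proof -
    have "(Z - G) \<bullet> (V - G) = 0"
      by (rule orth[OF that(1)])
    \<comment> \<open>Pythagoras, since \<open>Z - V\<close> is the difference of the orthogonal
      vectors \<open>Z - G\<close> and \<open>V - G\<close>.\<close>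
    then have "(norm ((Z - G) - (V - G)))\<^sup>2 = (norm (Z - G))\<^sup>2 + (norm (V - G))\<^sup>2"
      unfolding power2_norm_eq_inner inner_diff_left[of "Z - G"] inner_diff_right[of _ "Z - G"]
      by (simp only: inner_commute[of "V - G" "Z - G"])
    with that(2) have "(norm (Z - G))\<^sup>2 < (norm (Z - V))\<^sup>2"
      by simp
    then show ?thesis
      by (rule power_less_imp_less_base) simp
  qed
  with \<open>G \<in> S\<close> show ?thesis
    unfolding proj_def is_arg_min_def by (force simp: less_imp_not_less)
qed

lemma proj_mem: "Z \<in> S \<Longrightarrow> proj S Z = {Z}" for Z :: "'a::real_inner"
  by (rule proj_eq_singleton) auto

lemma proj_rank_eq_0: "proj (rank_eq 0) A = {0}"
  by (rule proj_eq_singleton) (auto simp: rank_eq_def rank_eq_0)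

text \<open>The tangent cones are never computed in full: projecting takes membership of the claimed
  point, supplied here by a constant sequence of directions, and at \<open>diag2 a 0\<close> also a
  linear constraint on all tangent vectors.\<close>

lemma tangent_cone_ray:
  assumes "\<And>t. t > 0 \<Longrightarrow> A + t *\<^sub>R V \<in> S"
  shows "V \<in> tangent_cone S A"
  unfolding tangent_cone_def
  using assms LIMSEQ_inverse_real_of_nat
  by (auto intro!: exI[of _ "\<lambda>n. inverse (real (Suc n))"] exI[of _ "\<lambda>_. V"])

text \<open>The determinant of \<open>diag2 a 0 + t *\<^sub>R W\<close> has no term constant in
  \<open>t\<close>; dividing its vanishing by \<open>t\<close> and letting \<open>t\<close> tend to
  0 leaves \<open>a * V$2$2 = 0\<close>.\<close>

lemma tangent_cone_rank_le1_diag2: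
  assumes "a \<noteq> 0" "V \<in> tangent_cone rank_le1 (diag2 a 0)"
  shows "V$2$2 = 0"
proof -
  obtain t W where t: "\<And>i::nat. t i > 0" "t \<longlonglongrightarrow> 0" and W: "W \<longlonglongrightarrow> V"
    and mem: "\<And>i. diag2 a 0 + t i *\<^sub>R W i \<in> rank_le1"
    using assms(2) unfolding tangent_cone_def by blast
  have eq: "a * W i $ 2 $ 2 + t i * det (W i) = 0" for i
  proof -
    have "t i * (a * W i $ 2 $ 2 + t i * det (W i)) = 0"
      using mem[of i] by (simp add: rank_le1_iff_det det_2 algebra_simps)
    with t(1)[of i] show ?thesis by simp
  qed
  have "(\<lambda>i. a * W i $ 2 $ 2 + t i * det (W i)) \<longlonglongrightarrow> a * V $ 2 $ 2 + 0 * det V"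
    unfolding det_2 by (intro tendsto_intros t W)
  then show ?thesis
    using eq assms(1) LIMSEQ_unique[OF _ tendsto_const[of 0]] by fastforce
qed

lemma grad_eqI:
  assumes "GDERIV f A :> D"
  shows "grad f A = D"
  unfolding grad_def
proof (rule the_equality)
  show "GDERIV f A :> D" by (rule assms)
next
  fix D' assume "GDERIV f A :> D'"
  then have "(\<lambda>h. h \<bullet> D') = (\<lambda>h. h \<bullet> D)"
    using assms unfolding gderiv_def by (rule has_derivative_unique)
  then show "D' = D"
    by (metis inner_commute vector_eq_rdot)
qed

section \<open>Singular values and the \<Delta>-rank\<close>

lemma svd_det_norm:
  assumes "is_svd A U s1 s2 V"
  shows "\<bar>det A\<bar> = s1 * s2" "(norm A)\<^sup>2 = s1\<^sup>2 + s2\<^sup>2"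
proof -
  have U: "transpose U ** U = mat 1" "\<bar>det U\<bar> = 1"
    and V: "transpose V ** V = mat 1" "\<bar>det V\<bar> = 1"
    and s: "0 \<le> s1" "0 \<le> s2" and A: "A = U ** diag2 s1 s2 ** transpose V"
    using assms det_orthogonal_matrix[of U] det_orthogonal_matrix[of V]
    by (auto simp: is_svd_def orthogonal_matrix)
  show "\<bar>det A\<bar> = s1 * s2"
    using U V s by (simp add: A det_mul det_diag2 abs_mult)
  have tr: "trace (transpose B ** B) = (norm B)\<^sup>2" for B :: mat2
    by (simp add: power2_norm_eq_inner inner_mat2 trace_def sum_2 matrix_matrix_mult_def transpose_def)
  let ?D = "diag2 s1 s2"
  have "(norm A)\<^sup>2 = trace (transpose A ** A)"
    by (simp add: tr)
  \<comment> \<open>Bracketed so that cyclicity of the trace brings \<open>V\<close> next to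
    \<open>transpose V\<close>, where the two cancel.\<close>
  also have "transpose A ** A = V ** (transpose ?D ** (transpose U ** U) ** ?D ** transpose V)"
    by (simp add: A matrix_transpose_mul matrix_mul_assoc)
  also have "trace \<dots> = trace (transpose ?D ** ?D ** (transpose V ** V))"
    by (subst trace_mul_sym) (simp add: U matrix_mul_assoc)
  also have "\<dots> = (norm ?D)\<^sup>2"
    by (simp add: V tr)
  also have "\<dots> = s1\<^sup>2 + s2\<^sup>2"
    by (simp add: norm_mat2_eq)
  finally show "(norm A)\<^sup>2 = s1\<^sup>2 + s2\<^sup>2" .
qed

text \<open>The determinant gives \<open>s1 * s2 = 0\<close> for every decomposition, so
  \<open>s2 = 0\<close> by the ordering, and the Frobenius norm then fixes \<open>s1\<close>. One
  decomposition thus determines the definite description.\<close>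

lemma singular_values_rank_le1:
  assumes "is_svd A U s 0 V"
  shows "singular_values A = (norm A, 0)"
proof -
  have unique: "s1 = norm A \<and> s2 = 0" if "is_svd A U' s1 s2 V'" for U' s1 s2 V'
  proof -
    have "s1 \<ge> s2" "s2 \<ge> 0" "s1 * s2 = 0" "(norm A)\<^sup>2 = s1\<^sup>2 + s2\<^sup>2"
      using that svd_det_norm[OF that] svd_det_norm[OF assms] by (auto simp: is_svd_def)
    then show ?thesis
      by auto
  qed
  show ?thesis
    unfolding singular_values_def
  proof (rule the_equality)
    show "\<exists>U V. is_svd A U (fst (norm A, 0)) (snd (norm A, 0)) V"
      using assms unique[OF assms] by auto
  next
    fix p assume "\<exists>U V. is_svd A U (fst p) (snd p) V"
    then show "p = (norm A, 0)"
      using unique by (metis prod.collapse)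
  qed
qed

lemma singular_values_diag2:
  assumes "a \<ge> 0"
  shows "singular_values (diag2 a 0) = (a, 0)" "singular_values (diag2 0 a) = (a, 0)"
proof -
  \<comment> \<open>Swaps the coordinates: \<open>is_svd\<close> wants the larger singular value
    first, but \<open>diag2 0 a\<close> carries it last.\<close>
  define P :: mat2 where "P = vector [vector [0, 1], vector [1, 0]]"
  have "is_svd (diag2 a 0) (mat 1) a 0 (mat 1)"
    using assms by (simp add: is_svd_def orthogonal_matrix_id transpose_mat)
  from singular_values_rank_le1[OF this] assms show "singular_values (diag2 a 0) = (a, 0)"
    by simp
  have "is_svd (diag2 0 a) P a 0 P"
    using assms
    by (auto simp: is_svd_def P_def orthogonal_matrix mat2_eq_iff matrix_matrix_mult_def
        transpose_def sum_2 mat_def)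
  from singular_values_rank_le1[OF this] assms show "singular_values (diag2 0 a) = (a, 0)"
    by simp
qed

lemma delta_rank_rank1:
  assumes "rank A = 1"
  shows "delta_rank \<Delta> A = (if fst (singular_values A) > \<Delta> then 1 else 0)"
proof -
  have "{j \<in> {1..rank A}. sing_val A j > \<Delta>} = (if fst (singular_values A) > \<Delta> then {1} else {})"
    using assms by (auto simp: sing_val_def)
  moreover have "A \<noteq> 0"
    using assms by auto
  ultimately show ?thesis
    by (simp add: delta_rank_def)
qed

section \<open>The two maps of the algorithm when their choices are forced\<close>

lemma stat_measure_eq: "proj_neg_grad f A = {G} \<Longrightarrow> stat_measure f A = norm G"
  by (simp add: stat_measure_def)

text \<open>The first trial point is already feasible, so it is its own projection, and it passes
  the Armijo test, so \<open>shrink\<close> never fires.\<close>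

lemma p2gd_eq_singleton:
  assumes G: "proj_neg_grad f A = {G}" "G \<noteq> 0"
    and mem: "A \<in> rank_le1" "A + \<alpha> *\<^sub>R G \<in> rank_le1"
    and armijo: "f (A + \<alpha> *\<^sub>R G) \<le> f A - c * \<alpha> * (norm G)\<^sup>2"
  shows "p2gd f \<alpha> \<alpha> \<beta> c A = {A + \<alpha> *\<^sub>R G}"
proof -
  have "a = \<alpha> \<and> Y = A + \<alpha> *\<^sub>R G" if "backtracking f \<alpha> \<alpha> \<beta> c A G a Y" for a Y
    using that
  proof induction
    case (start a Y)
    then have "a = \<alpha>" by simp
    with start.hyps(3) show ?case by (simp add: proj_mem[OF mem(2)])
  next
    case (shrink a Y Y')
    then show ?case
      using armijo by (auto simp: stat_measure_eq[OF G(1)])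
  qed
  moreover have "backtracking f \<alpha> \<alpha> \<beta> c A G \<alpha> (A + \<alpha> *\<^sub>R G)"
    by (rule backtracking.start) (simp_all add: proj_mem[OF mem(2)])
  ultimately have "backtracking f \<alpha> \<alpha> \<beta> c A G a Y \<longleftrightarrow> a = \<alpha> \<and> Y = A + \<alpha> *\<^sub>R G" for a Y
    by blast
  then show ?thesis
    using G mem armijo by (auto simp: p2gd_def stat_measure_eq[OF G(1)] not_less)
qed

text \<open>Only \<open>j = 0\<close> remains, and \<open>A\<close> is its own projection onto the
  matrices of its rank.\<close>

lemma p2gdr_delta_rank_eq_rank:
  assumes "A \<in> rank_le1" "stat_measure f A > 0" "delta_rank \<Delta> A = rank A"
    and "p2gd f al au \<beta> c A = {Y}"
  shows "p2gdr f al au \<beta> c \<Delta> A = {Y}"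
proof -
  have "proj (rank_eq (rank A)) A = {A}"
    by (rule proj_mem) (simp add: rank_eq_def)
  then have "(\<forall>j \<in> {0..rank A - delta_rank \<Delta> A}.
      Xhat j \<in> proj (rank_eq (rank A - j)) A \<and> Xtilde j \<in> p2gd f al au \<beta> c (Xhat j)) \<longleftrightarrow>
      Xhat 0 = A \<and> Xtilde 0 = Y" for Xhat Xtilde
    using assms by auto
  moreover have "\<exists>Xhat Xtilde. Xhat (0::nat) = A \<and> Xtilde (0::nat) = Y"
    by (intro exI[of _ "\<lambda>_. A"] exI[of _ "\<lambda>_. Y"]) simp
  ultimately show ?thesis
    using assms unfolding p2gdr_def by (auto simp: is_arg_min_def)
qed

text \<open>The indices are 0 and 1: one candidate starts from \<open>A\<close> itself, the other
  from the only matrix of rank 0.\<close>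

lemma p2gdr_delta_rank_0:
  assumes "rank A = 1" "stat_measure f A > 0" "delta_rank \<Delta> A = 0"
    and Y: "p2gd f al au \<beta> c A = {Y0}" "p2gd f al au \<beta> c 0 = {Y1}"
  shows "p2gdr f al au \<beta> c \<Delta> A = {Y. is_arg_min f (\<lambda>Z. Z \<in> {Y0, Y1}) Y}"
proof -
  have "A \<in> rank_le1" using assms by (simp add: rank_le1_def)
  have "proj (rank_eq 1) A = {A}"
    by (rule proj_mem) (simp add: rank_eq_def assms)
  moreover have I: "{0..rank A - delta_rank \<Delta> A} = {0, 1}"
    using assms by auto
  ultimately have choices: "(\<forall>j \<in> {0..rank A - delta_rank \<Delta> A}.
      Xhat j \<in> proj (rank_eq (rank A - j)) A \<and> Xtilde j \<in> p2gd f al au \<beta> c (Xhat j)) \<longleftrightarrow>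
      Xhat 0 = A \<and> Xtilde 0 = Y0 \<and> Xhat 1 = 0 \<and> Xtilde 1 = Y1" for Xhat Xtilde
    using assms(1) Y unfolding I by (auto simp: proj_rank_eq_0)
  \<comment> \<open>The choice functions live on all of \<open>nat\<close>; their values beyond
    index 1 are arbitrary.\<close>
  have "\<exists>Xhat Xtilde. Xhat (0::nat) = A \<and> Xtilde (0::nat) = Y0 \<and> Xhat 1 = 0 \<and> Xtilde 1 = Y1"
    by (intro exI[of _ "\<lambda>j. if j = 0 then A else 0"] exI[of _ "\<lambda>j. if j = 0 then Y0 else Y1"]) simp
  then show ?thesis
    unfolding p2gdr_def choices using I \<open>A \<in> rank_le1\<close> assms(2)
    by (auto simp: I)
qed

section \<open>The cost and its projected negative gradient\<close>

definition cost :: "mat2 \<Rightarrow> real" where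
  "cost M = ((M$1$1)\<^sup>2 + (M$2$2 - 1)\<^sup>2 + (M$1$2 - M$2$1)\<^sup>2) / 2"

lemma cost_diag2: "cost (diag2 a b) = (a\<^sup>2 + (b - 1)\<^sup>2) / 2"
  by (simp add: cost_def)

lemma grad_cost_diag2: "grad cost (diag2 a b) = diag2 a (b - 1)"
proof (rule grad_eqI)
  show "GDERIV cost (diag2 a b) :> diag2 a (b - 1)"
    unfolding gderiv_def cost_def [abs_def]
    by (auto intro!: derivative_eq_intros bounded_linear.has_derivative[OF bounded_linear_vec_nth]
        simp: inner_mat2 fun_eq_iff field_simps)
qed

lemma proj_neg_grad_diag2_fst:
  assumes "a \<noteq> 0"
  shows "proj_neg_grad cost (diag2 a 0) = {diag2 (-a) 0}"
proof -
  \<comment> \<open>The residual of the projection lives in position (2,2), where all tangent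
    vectors vanish, so it is orthogonal to them.\<close>
  have [simp]: "- diag2 a (-1) - diag2 (-a) 0 = diag2 0 1"
    by (simp add: mat2_eq_iff)
  show ?thesis
    unfolding proj_neg_grad_def grad_cost_diag2
    using tangent_cone_rank_le1_diag2[OF assms]
    by (intro proj_eq_singleton tangent_cone_ray)
      (auto simp: diag2_add_scaleR rank_le1_iff_det det_diag2 inner_mat2)
qed

text \<open>The negative gradient points along the line of matrices \<open>diag2 0 b\<close>. The
  case \<open>b = 0\<close> serves the reduced candidate.\<close>

lemma proj_neg_grad_diag2_snd: "proj_neg_grad cost (diag2 0 b) = {diag2 0 (1 - b)}"
proof -
  have "- diag2 0 (b - 1) = diag2 0 (1 - b)"
    by (simp add: mat2_eq_iff)
  then show ?thesis
    unfolding proj_neg_grad_def grad_cost_diag2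
    by (auto intro!: proj_mem tangent_cone_ray
        simp: diag2_add_scaleR rank_le1_iff_det det_diag2)
qed

lemmas stat_measure_diag2 =
  stat_measure_eq[OF proj_neg_grad_diag2_fst] stat_measure_eq[OF proj_neg_grad_diag2_snd]

text \<open>With \<open>r = a\<close> or \<open>r = 1 - b\<close>, the cost is
  \<open>r^2 / 2\<close> up to a constant, the stationarity measure is the absolute value of
  \<open>r\<close>, and a step multiplies \<open>r\<close> by \<open>1 - \<alpha>\<close>.\<close>

lemma armijo_factor:
  fixes \<alpha> c r :: real
  assumes "0 < \<alpha>" "\<alpha> < 1" "c \<le> 1/2"
  shows "((1 - \<alpha>) * r)\<^sup>2 / 2 \<le> r\<^sup>2 / 2 - c * \<alpha> * r\<^sup>2"
proof -
  have "c * \<alpha> \<le> 1/2 * \<alpha>"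
    using assms by (intro mult_right_mono) auto
  moreover have "\<alpha>\<^sup>2 \<le> \<alpha>"
    using assms by (simp add: power2_eq_square mult_left_le)
  ultimately have "0 \<le> (\<alpha> - \<alpha>\<^sup>2 / 2 - c * \<alpha>) * r\<^sup>2"
    by (intro mult_nonneg_nonneg) auto
  then show ?thesis
    by (simp add: power2_eq_square field_simps)
qed

section \<open>Steps of the algorithm from the two half-lines\<close>

context
  fixes \<alpha> \<beta> c :: real
  assumes \<alpha>: "0 < \<alpha>" "\<alpha> < 1" and c: "c \<le> 1/2"
begin

lemma p2gd_diag2_fst:
  assumes "a \<noteq> 0"
  shows "p2gd cost \<alpha> \<alpha> \<beta> c (diag2 a 0) = {diag2 ((1 - \<alpha>) * a) 0}"
proof -
  have step: "diag2 a 0 + \<alpha> *\<^sub>R diag2 (- a) 0 = diag2 ((1 - \<alpha>) * a) 0"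
    by (simp add: diag2_add_scaleR algebra_simps)
  show ?thesis
    using p2gd_eq_singleton[OF proj_neg_grad_diag2_fst[OF assms], of \<alpha> c \<beta>, unfolded step]
      assms armijo_factor[OF \<alpha> c, of a]
    by (simp add: rank_le1_iff_det det_diag2 diag2_eq_0_iff cost_diag2 add_divide_distrib)
qed

lemma p2gd_diag2_snd:
  assumes "b \<noteq> 1"
  shows "p2gd cost \<alpha> \<alpha> \<beta> c (diag2 0 b) = {diag2 0 (1 - (1 - \<alpha>) * (1 - b))}"
proof -
  have step: "diag2 0 b + \<alpha> *\<^sub>R diag2 0 (1 - b) = diag2 0 (1 - (1 - \<alpha>) * (1 - b))"
    by (simp add: diag2_add_scaleR algebra_simps)
  show ?thesis
    using p2gd_eq_singleton[OF proj_neg_grad_diag2_snd, of b \<alpha> c \<beta>, unfolded step]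
      assms armijo_factor[OF \<alpha> c, of "1 - b"]
    by (simp add: rank_le1_iff_det det_diag2 diag2_eq_0_iff cost_diag2 power2_commute[of b 1])
qed

lemma p2gd_0: "p2gd cost \<alpha> \<alpha> \<beta> c 0 = {diag2 0 \<alpha>}"
  using p2gd_diag2_snd[of 0] diag2_eq_0_iff[of 0 0] by simp

lemma p2gdr_diag2_fst:
  assumes "a > 0"
  shows "p2gdr cost \<alpha> \<alpha> \<beta> c \<Delta> (diag2 a 0) =
    {if \<Delta> < a then diag2 ((1 - \<alpha>) * a) 0 else diag2 0 \<alpha>}"
proof -
  have rank: "rank (diag2 a 0) = 1"
    using assms by (simp add: rank_diag2_zero)
  have delta: "delta_rank \<Delta> (diag2 a 0) = (if \<Delta> < a then 1 else 0)"
    using assms by (simp add: delta_rank_rank1[OF rank] singular_values_diag2)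
  have stat: "stat_measure cost (diag2 a 0) > 0"
    using assms by (simp add: stat_measure_diag2)
  have p2gd: "p2gd cost \<alpha> \<alpha> \<beta> c (diag2 a 0) = {diag2 ((1 - \<alpha>) * a) 0}"
    using assms by (simp add: p2gd_diag2_fst)
  show ?thesis
  proof (cases "\<Delta> < a")
    case True
    then show ?thesis
      using p2gdr_delta_rank_eq_rank[OF _ stat _ p2gd] rank delta by (simp add: rank_le1_def)
  next
    case False
    \<comment> \<open>The reduced candidate costs less than 1/2, whereas every
      \<open>diag2 r 0\<close> costs at least 1/2.\<close>
    have "(\<alpha> - 1)\<^sup>2 < 1"
      using \<alpha> by (simp add: abs_square_less_1)
    then have "cost (diag2 0 \<alpha>) < cost (diag2 ((1 - \<alpha>) * a) 0)"
      by (simp add: cost_diag2 add_strict_increasing2)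
    then show ?thesis
      using False p2gdr_delta_rank_0[OF rank stat _ p2gd p2gd_0] delta
      by (auto simp: is_arg_min_def)
  qed
qed

lemma p2gdr_diag2_snd:
  assumes "0 < b" "b < 1"
  shows "p2gdr cost \<alpha> \<alpha> \<beta> c \<Delta> (diag2 0 b) = {diag2 0 (1 - (1 - \<alpha>) * (1 - b))}"
proof -
  have rank: "rank (diag2 0 b) = 1"
    using assms by (simp add: rank_diag2_zero)
  have delta: "delta_rank \<Delta> (diag2 0 b) = (if \<Delta> < b then 1 else 0)"
    using assms by (simp add: delta_rank_rank1[OF rank] singular_values_diag2)
  have stat: "stat_measure cost (diag2 0 b) > 0"
    using assms by (simp add: stat_measure_diag2)
  have p2gd: "p2gd cost \<alpha> \<alpha> \<beta> c (diag2 0 b) = {diag2 0 (1 - (1 - \<alpha>) * (1 - b))}"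
    using assms by (simp add: p2gd_diag2_snd)
  show ?thesis
  proof (cases "\<Delta> < b")
    case True
    then show ?thesis
      using p2gdr_delta_rank_eq_rank[OF _ stat _ p2gd] rank delta by (simp add: rank_le1_def)
  next
    case False
    \<comment> \<open>Restarting from 0 leaves the distance \<open>1 - \<alpha>\<close> to the
      minimizer \<open>diag2 0 1\<close>; starting from \<open>b > 0\<close> leaves strictly
      less.\<close>
    have "((1 - \<alpha>) * (1 - b))\<^sup>2 < (1 - \<alpha>)\<^sup>2"
      using \<alpha> assms by (intro power_strict_mono) auto
    then have "cost (diag2 0 (1 - (1 - \<alpha>) * (1 - b))) < cost (diag2 0 \<alpha>)"
      by (simp add: cost_diag2 power2_commute[of \<alpha> 1])
    then show ?thesis
      using False p2gdr_delta_rank_0[OF rank stat _ p2gd p2gd_0] delta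
      by (auto simp: is_arg_min_def)
  qed
qed

end

section \<open>Whole runs and the switching index\<close>

lemma p2gdr_producesI:
  assumes "X 0 = X0" and "\<And>i. stat_measure f (X i) > 0"
    and step: "\<And>i. p2gdr f al au \<beta> c \<Delta> (X i) = {X (Suc i)}"
  shows "p2gdr_produces f al au \<beta> c \<Delta> X0 X"
proof -
  \<comment> \<open>Singleton outputs make \<open>X\<close> a run; the induction shows that any
    other run must follow it.\<close>
  have "Z i = X i" if "p2gdr_iterates f al au \<beta> c \<Delta> X0 n Z" "i \<le> n" for n Z i
    using that(2)
  proof (induction i)
    case 0
    then show ?case using that assms by (simp add: p2gdr_iterates_def)
  next
    case (Suc i)
    have "Z (Suc i) \<in> p2gdr f al au \<beta> c \<Delta> (Z i)"
      using that(1) Suc.prems by (simp add: p2gdr_iterates_def)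
    then show ?case using Suc step by simp
  qed
  then show ?thesis
    using assms by (simp add: p2gdr_produces_def p2gdr_iterates_def)
qed

text \<open>Multiplying by \<open>ln q < 0\<close> reverses the inequality. The ceiling is therefore
  the first index at which the singular value is at most \<Delta>.\<close>

lemma ceil_log_ratio_le_iff:
  fixes x0 q \<Delta> :: real
  assumes "0 < x0" "0 < q" "q < 1" "0 < \<Delta>"
  shows "nat (max \<lceil>ln (\<Delta> / x0) / ln q\<rceil> 0) \<le> i \<longleftrightarrow> q ^ i * x0 \<le> \<Delta>"
proof -
  have "nat (max \<lceil>ln (\<Delta> / x0) / ln q\<rceil> 0) \<le> i \<longleftrightarrow> ln (\<Delta> / x0) / ln q \<le> real i"
    by (auto simp: nat_le_iff ceiling_le_iff)
  also have "\<dots> \<longleftrightarrow> ln (q ^ i) \<le> ln (\<Delta> / x0)"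
    using assms by (simp add: neg_divide_le_eq ln_realpow)
  also have "\<dots> \<longleftrightarrow> q ^ i * x0 \<le> \<Delta>"
    using assms by (subst ln_le_cancel_iff) (simp_all add: pos_le_divide_eq)
  finally show ?thesis .
qed

theorem proposition2:
  fixes x0 \<alpha> \<beta> c \<Delta> :: real and f :: "mat2 \<Rightarrow> real" and i\<Delta> :: nat and X :: "nat \<Rightarrow> mat2"
  assumes "0 < x0" and "0 < \<alpha>" and "\<alpha> < 1" and "0 < \<beta>" and "\<beta> < 1"
    and "0 < c" and "c \<le> 1/2" and "0 < \<Delta>"
    and f_def: "\<And>M. f M = ((M$1$1)\<^sup>2 + (M$2$2 - 1)\<^sup>2 + (M$1$2 - M$2$1)\<^sup>2) / 2"
    and i\<Delta>_def: "i\<Delta> = nat (max \<lceil>ln (\<Delta> / x0) / ln (1 - \<alpha>)\<rceil> 0)"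
    and X_def: "\<And>i. X i = (if i \<le> i\<Delta> then diag2 ((1 - \<alpha>) ^ i * x0) 0
                            else diag2 0 (1 - (1 - \<alpha>) ^ (i - i\<Delta>)))"
  shows "p2gdr_produces f \<alpha> \<alpha> \<beta> c \<Delta> (diag2 x0 0) X \<and>
         X \<longlonglongrightarrow> diag2 0 1 \<and>
         (\<lambda>i. stat_measure f (X i)) \<longlonglongrightarrow> 0"
proof (intro conjI)
  have f: "f = cost"
    by (simp add: fun_eq_iff f_def cost_def)
  define q where "q = 1 - \<alpha>"
  have q: "0 < q" "q < 1"
    using assms by (auto simp: q_def)
  have i\<Delta>: "i\<Delta> \<le> i \<longleftrightarrow> q ^ i * x0 \<le> \<Delta>" for i
    unfolding i\<Delta>_def q_def[symmetric] using assms q by (intro ceil_log_ratio_le_iff) auto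
  have stat_tail: "stat_measure f (diag2 0 (1 - q ^ k)) = q ^ k" for k
    using q by (simp add: f stat_measure_diag2)
  \<comment> \<open>The shift by \<open>Suc i\<Delta>\<close> puts every index in the second branch,
    with exponent at least 1.\<close>
  have X_tail: "X (i + Suc i\<Delta>) = diag2 0 (1 - q ^ Suc i)" for i
    by (simp add: X_def q_def)
  have q_tail: "(\<lambda>i. q ^ Suc i) \<longlonglongrightarrow> 0"
    using q by (intro LIMSEQ_Suc LIMSEQ_power_zero) auto
  show "p2gdr_produces f \<alpha> \<alpha> \<beta> c \<Delta> (diag2 x0 0) X"
  proof (rule p2gdr_producesI)
    show "X 0 = diag2 x0 0"
      by (simp add: X_def)
    show "stat_measure f (X i) > 0" for i
      using q assms(1) stat_tail[of "i - i\<Delta>"]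
      by (simp add: X_def f stat_measure_diag2 q_def[symmetric])
    show "p2gdr f \<alpha> \<alpha> \<beta> c \<Delta> (X i) = {X (Suc i)}" for i
    proof (cases "i \<le> i\<Delta>")
      case True
      have "p2gdr cost \<alpha> \<alpha> \<beta> c \<Delta> (diag2 (q ^ i * x0) 0) =
          {if \<Delta> < q ^ i * x0 then diag2 (q ^ Suc i * x0) 0 else diag2 0 \<alpha>}"
        using p2gdr_diag2_fst[OF assms(2,3,7), of "q ^ i * x0"] q assms(1)
        by (simp add: q_def mult.assoc)
      \<comment> \<open>The test succeeds for \<open>i < i\<Delta>\<close> and fails at
        \<open>i = i\<Delta>\<close>, where the jump lands on \<open>diag2 0 \<alpha>\<close>; this
        is the next iterate because \<open>1 - q ^ 1 = \<alpha>\<close>.\<close>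
      then show ?thesis
        using True i\<Delta>[of i] by (auto simp: f X_def q_def[symmetric] not_le Suc_diff_le)
          (auto simp: q_def)
    next
      case False
      \<comment> \<open>The exponent is positive here, which keeps the iterate away from 0 as the
        comparison with the reduced candidate requires.\<close>
      have "0 < 1 - q ^ (i - i\<Delta>)" "1 - q ^ (i - i\<Delta>) < 1"
        using q False by (auto simp: power_less_one_iff)
      then show ?thesis
        using False p2gdr_diag2_snd[OF assms(2,3,7)]
        by (simp add: f X_def q_def Suc_diff_le)
    qed
  qed
  show "X \<longlonglongrightarrow> diag2 0 1"
  proof (rule LIMSEQ_offset[where k = "Suc i\<Delta>"])
    have "X (i + Suc i\<Delta>) = (1 - q ^ Suc i) *\<^sub>R diag2 0 1" for i
      unfolding X_tail by (simp add: mat2_eq_iff)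
    moreover have "(\<lambda>i. (1 - q ^ Suc i) *\<^sub>R diag2 0 1) \<longlonglongrightarrow> (1 - 0) *\<^sub>R diag2 0 1"
      by (intro tendsto_intros q_tail)
    ultimately show "(\<lambda>i. X (i + Suc i\<Delta>)) \<longlonglongrightarrow> diag2 0 1"
      by (simp only: diff_zero scaleR_one)
  qed
  show "(\<lambda>i. stat_measure f (X i)) \<longlonglongrightarrow> 0"
    by (rule LIMSEQ_offset[where k = "Suc i\<Delta>"]) (simp only: X_tail stat_tail q_tail)
qed

end
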